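(* Let $k\ge 1$ be an integer. The polytope $GZ(1\,2^k\,3)$ has dimension $2k+1$, and the components of its $h$-vector $(h_0,h_1,\dots,h_{2k+1})$ are $h_{2k+1}=1$ and $$h_i=\begin{cases} i+1, & \text{if } 0\le i\le k+1,\\ 2k+3-i, & \text{if } k+1<i\le 2k.\end{cases}$$
   Context: Gelfand–Zetlin polytope: for real numbers $\lambda_1\le\dots\le\lambda_s$, $GZ(\lambda_1\dots\lambda_s)\subset\mathbb{R}^{s(s-1)/2}$ is the convex polytope of all points with coordinates $u_{i,j}$ ($1\le i\le s-1$, $1\le j\le s-i$) satisfying $u_{i-1,j}\le u_{i,j}\le u_{i-1,j+1}$ for all such $i,j$, where $u_{0,j}:=\lambda_j$. Multiplicative notation is used for repetitions: $GZ(1\,2^k\,3)$ is the polytope of the sequence $1,2,\dots,2,3$ with $k$ copies of $2$. For a polytope $P$ of dimension $n$, $f_P(t)=\sum_{d=0}^n f_d t^d$, where $f_d$ is the number of $d$-dimensional faces of $P$ (nonempty faces, $P$ itself included, so $f_n=1$). The $h$-polynomial of $P$ is defined (for arbitrary, not necessarily simple, $P$) by $h_P(s)=f_P(s-1)=\sum_{i=0}^n h_i s^i$, i.e. $h_i=\sum_{d=i}^n(-1)^{d-i}\binom{d}{i}f_d$; the sequence $(h_0,\dots,h_n)$ is the $h$-vector. *)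

theory Defs
  imports "HOL-Analysis.Analysis" "HOL-Computational_Algebra.Polynomial"
begin

definition face_number :: "'a::euclidean_space set \<Rightarrow> nat \<Rightarrow> nat" where
  "face_number P d = card {F. F face_of P \<and> F \<noteq> {} \<and> aff_dim F = int d}"

definition f_poly :: "'a::euclidean_space set \<Rightarrow> int poly" where
  "f_poly P = (\<Sum>d = 0..nat (aff_dim P). monom (int (face_number P d)) d)"

definition h_poly :: "'a::euclidean_space set \<Rightarrow> int poly" where
  "h_poly P = pcompose (f_poly P) [:-1, 1:]"

definition GZ_index :: "nat \<Rightarrow> (nat \<times> nat) set" where
  "GZ_index s = {(i, j). 1 \<le> i \<and> i \<le> s - 1 \<and> 1 \<le> j \<and> j \<le> s - i}"

text \<open>The ambient space is \<open>real ^ 'n\<close> with \<open>s (s - 1) / 2\<close> coordinates; a labelling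
  \<open>c\<close> says which of them, \<open>c (i, j) :: 'n\<close>, is the one called \<open>u\<^sub>i\<^sub>,\<^sub>j\<close>. Every
  index type of that cardinality has a labelling (\<open>GZ_labelling_exists\<close>).\<close>

definition GZ_labelling :: "nat \<Rightarrow> (nat \<times> nat \<Rightarrow> 'n::finite) \<Rightarrow> bool" where
  "GZ_labelling s c \<longleftrightarrow> bij_betw c (GZ_index s) UNIV"

lemma card_GZ_index: "finite (GZ_index s) \<and> card (GZ_index s) = s * (s - 1) div 2"
proof -
  have eq: "GZ_index s = (SIGMA i:{1..s - 1}. {1..s - i})"
    by (auto simp: GZ_index_def)
  have "(\<Sum>i = 1..s - 1. s - i) = (\<Sum>i = 1..s - 1. i)"
    by (rule sum.reindex_bij_witness[of _ "\<lambda>i. s - i" "\<lambda>i. s - i"]) auto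
  also have "\<dots> = (s - 1) * Suc (s - 1) div 2"
    using gauss_sum_from_Suc_0[of "s - 1", where ?'a = nat] by simp
  also have "\<dots> = s * (s - 1) div 2"
    by (cases s) (auto simp: mult.commute)
  finally show ?thesis
    unfolding eq by (simp add: card_SigmaI)
qed

lemma GZ_labelling_exists:
  assumes "CARD('n::finite) = s * (s - 1) div 2"
  shows "\<exists>c :: nat \<times> nat \<Rightarrow> 'n. GZ_labelling s c"
  using assms card_GZ_index[of s] unfolding GZ_labelling_def
  by (metis finite finite_same_card_bij)

definition GZ_coord ::
    "(nat \<times> nat \<Rightarrow> 'n::finite) \<Rightarrow> real list \<Rightarrow> real ^ 'n \<Rightarrow> nat \<Rightarrow> nat \<Rightarrow> real" where
  "GZ_coord c lam x i j = (if i = 0 then lam ! (j - 1) else x $ c (i, j))"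

definition GZ :: "(nat \<times> nat \<Rightarrow> 'n::finite) \<Rightarrow> real list \<Rightarrow> (real ^ 'n) set" where
  "GZ c lam = {x. \<forall>(i, j) \<in> GZ_index (length lam).
      GZ_coord c lam x (i - 1) j \<le> GZ_coord c lam x i j \<and>
      GZ_coord c lam x i j \<le> GZ_coord c lam x (i - 1) (j + 1)}"

end

theory Submission
  imports Defs
begin

text \<open>
  The interlacing conditions force every \<open>u\<^sub>i\<^sub>,\<^sub>j\<close> with \<open>2 \<le> j\<close>, \<open>i + j \<le> k + 1\<close> to
  be \<open>2\<close>. What remains is a chain \<open>1 \<le> u\<^sub>1\<^sub>,\<^sub>1 \<le> \<dots> \<le> u\<^sub>k\<^sub>,\<^sub>1 \<le> 2\<close>, a chain descending
  from \<open>3\<close> to \<open>2\<close>, and an apex between the last terms of the two chains. In terms of the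
  nonnegative slacks \<open>\<alpha>\<^sub>0, \<dots>, \<alpha>\<^sub>k\<close>, \<open>\<beta>\<^sub>0, \<dots>, \<beta>\<^sub>k\<close>, \<open>\<gamma>\<close>, \<open>\<delta>\<close> the polytope is cut out by
  \<open>\<Sum>\<alpha> = 1\<close>, \<open>\<Sum>\<beta> = 1\<close>, \<open>\<gamma> + \<delta> = \<alpha>\<^sub>k + \<beta>\<^sub>k\<close>. Nonempty faces correspond to supports of slack
  vectors, i.e. to triples \<open>(A, B, C)\<close> with \<open>A, B\<close> nonempty and \<open>C = {}\<close> exactly when
  \<open>k \<notin> A \<union> B\<close>; the dimension of the face is \<open>(|A| - 1) + (|B| - 1)\<close>, plus \<open>1\<close> if \<open>|C| = 2\<close>.
  Summing \<open>(X - 1)\<close> to the dimension over all triples gives \<open>h = (X + 1) [k + 1]\<^sup>2 - X [k]\<^sup>2\<close> with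
  \<open>[n] = 1 + X + \<dots> + X ^ (n - 1)\<close>.
\<close>

section \<open>Faces of a polyhedron given by an inequality system\<close>

text \<open>Equations go into the affine set \<open>M\<close>, inequalities into the slacks
  \<open>l\<close>. The parameter \<open>t\<close> ranges over all reals, so affinity also covers
  points beyond a segment.\<close>

locale affine_system =
  fixes M :: "'a::euclidean_space set" and I :: "'i set" and l :: "'i \<Rightarrow> 'a \<Rightarrow> real"
  assumes affine_M: "affine M"
    and finite_I: "finite I"
    and l_affine: "\<And>i t x y. i \<in> I \<Longrightarrow>
      l i ((1 - t) *\<^sub>R x + t *\<^sub>R y) = (1 - t) * l i x + t * l i y"
begin

definition Q :: "'a set" where
  "Q = {x \<in> M. \<forall>i\<in>I. 0 \<le> l i x}"

definition supp :: "'a \<Rightarrow> 'i set" where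
  "supp x = {i \<in> I. l i x \<noteq> 0}"

text \<open>For \<open>x\<close> in \<open>Q\<close>, \<open>flat (supp x)\<close> turns out to be
  the affine hull of the smallest face of \<open>Q\<close> containing \<open>x\<close>.\<close>

definition flat :: "'i set \<Rightarrow> 'a set" where
  "flat S = {x \<in> M. supp x \<subseteq> S}"

lemma M_comb: "x \<in> M \<Longrightarrow> y \<in> M \<Longrightarrow> (1 - t) *\<^sub>R x + t *\<^sub>R y \<in> M"
  using affine_M mem_affine[of M x y "1 - t" t] by simp

text \<open>Slacks positive at \<open>x\<close> stay positive nearby by continuity; those vanishing
  at \<open>x\<close> vanish at \<open>y\<close> too, hence on the whole line. Negative
  \<open>t\<close> is included, so the line continues inside \<open>Q\<close> on the far side of
  \<open>x\<close>.\<close>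

lemma prolong:
  assumes x: "x \<in> Q" and y: "y \<in> flat (supp x)"
  shows "\<exists>e>0. \<forall>t. \<bar>t\<bar> < e \<longrightarrow> (1 - t) *\<^sub>R x + t *\<^sub>R y \<in> Q \<inter> flat (supp x)"
proof -
  have xM: "x \<in> M" and lx: "\<And>i. i \<in> I \<Longrightarrow> 0 \<le> l i x"
    using x by (auto simp: Q_def)
  have yM: "y \<in> M" and zero: "\<And>i. i \<in> I \<Longrightarrow> l i x = 0 \<Longrightarrow> l i y = 0"
    using y by (auto simp: flat_def supp_def)
  have "\<forall>\<^sub>F t in nhds 0. 0 \<le> (1 - t) * l i x + t * l i y" if i: "i \<in> I" for i
  proof (cases "l i x = 0")
    case True
    then show ?thesis using zero[OF i] by simp
  next
    case False
    have "((\<lambda>t. (1 - t) * l i x + t * l i y) \<longlongrightarrow> (1 - 0) * l i x + 0 * l i y) (nhds 0)"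
      by (intro tendsto_intros filterlim_ident)
    moreover have "0 < (1 - 0) * l i x + 0 * l i y"
      using False lx[OF i] by simp
    ultimately have "\<forall>\<^sub>F t in nhds 0. 0 < (1 - t) * l i x + t * l i y"
      by (rule order_tendstoD(1))
    then show ?thesis by eventually_elim simp
  qed
  then have "\<forall>\<^sub>F t in nhds 0. \<forall>i\<in>I. 0 \<le> (1 - t) * l i x + t * l i y"
    by (intro eventually_ball_finite finite_I) auto
  then obtain e where "e > 0"
    and e: "\<And>t. \<bar>t\<bar> < e \<Longrightarrow> \<forall>i\<in>I. 0 \<le> (1 - t) * l i x + t * l i y"
    by (auto simp: eventually_nhds_metric dist_real_def)
  have "(1 - t) *\<^sub>R x + t *\<^sub>R y \<in> Q \<inter> flat (supp x)" if "\<bar>t\<bar> < e" for t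
    using e[OF that] M_comb[OF xM yM, of t] zero
    by (auto simp: Q_def flat_def supp_def l_affine)
  with \<open>e > 0\<close> show ?thesis by blast
qed

lemma convex_Q: "convex Q"
  unfolding convex_alt Q_def using M_comb by (auto simp: l_affine)

lemma affine_flat: "affine (flat S)"
  unfolding affine_def
proof (intro ballI allI impI)
  fix x y u v assume xy: "x \<in> flat S" "y \<in> flat S" and uv: "u + v = (1::real)"
  then have u: "u = 1 - v" by simp
  have "(1 - v) *\<^sub>R x + v *\<^sub>R y \<in> M" using xy by (simp add: flat_def M_comb)
  then show "u *\<^sub>R x + v *\<^sub>R y \<in> flat S"
    using xy unfolding u by (fastforce simp: flat_def supp_def l_affine)
qed

text \<open>A slack outside \<open>S\<close> is nonnegative at both ends of the segment, and a
  strictly positive weighting of the two values is zero, so both are zero.\<close>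

lemma flat_face_of: "(Q \<inter> flat S) face_of Q"
  unfolding face_of_def
proof (intro conjI ballI impI)
  show "convex (Q \<inter> flat S)"
    unfolding convex_alt
  proof (intro ballI allI impI)
    fix x y u assume xy: "x \<in> Q \<inter> flat S" "y \<in> Q \<inter> flat S" and u: "0 \<le> u \<and> u \<le> (1::real)"
    have "(1 - u) *\<^sub>R x + u *\<^sub>R y \<in> Q"
      using convex_Q xy u unfolding convex_alt by blast
    then show "(1 - u) *\<^sub>R x + u *\<^sub>R y \<in> Q \<inter> flat S"
      using xy by (fastforce simp: Q_def flat_def supp_def l_affine)
  qed
next
  fix a b x assume a: "a \<in> Q" and b: "b \<in> Q" and x: "x \<in> Q \<inter> flat S"
    and seg: "x \<in> open_segment a b"
  from seg obtain u where u: "0 < u" "u < 1" and xu: "x = (1 - u) *\<^sub>R a + u *\<^sub>R b"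
    by (auto simp: in_segment)
  have "l i a = 0 \<and> l i b = 0" if i: "i \<in> I" "i \<notin> S" for i
  proof -
    have "l i x = 0" using x i by (auto simp: flat_def supp_def)
    then have "(1 - u) * l i a + u * l i b = 0"
      using i by (simp add: xu l_affine)
    moreover have "0 \<le> (1 - u) * l i a" "0 \<le> u * l i b"
      using a b i u by (auto simp: Q_def)
    ultimately have "(1 - u) * l i a = 0" "u * l i b = 0" by linarith+
    then show ?thesis using u by simp
  qed
  then show "a \<in> Q \<inter> flat S" "b \<in> Q \<inter> flat S"
    using a b by (auto simp: Q_def flat_def supp_def)
qed auto

text \<open>Take \<open>x\<close> in the relative interior of \<open>F\<close>. A point of
  \<open>Q\<close> in \<open>flat (supp x)\<close> is an end of a segment in \<open>Q\<close>
  passing through \<open>x\<close>, so the face property puts it into \<open>F\<close>. Conversely,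
  a segment from any \<open>y\<close> in \<open>F\<close> extends beyond \<open>x\<close> inside
  \<open>F\<close>, so a slack that vanishes at \<open>x\<close> cannot be positive at
  \<open>y\<close>.\<close>

lemma face_of_eq_flat:
  assumes F: "F face_of Q" and ne: "F \<noteq> {}"
  obtains x where "x \<in> Q" "F = Q \<inter> flat (supp x)"
proof -
  have cF: "convex F" and FQ: "F \<subseteq> Q"
    using face_of_imp_convex[OF F] face_of_imp_subset[OF F] by auto
  obtain x where x: "x \<in> rel_interior F"
    using rel_interior_eq_empty[OF cF] ne by auto
  have xF: "x \<in> F" using x rel_interior_subset by auto
  have "y \<in> F" if y: "y \<in> Q \<inter> flat (supp x)" for y
  proof (cases "y = x")
    case False
    from prolong[of x y] y xF FQ obtain e where "e > 0"
      and e: "\<And>t. \<bar>t\<bar> < e \<Longrightarrow> (1 - t) *\<^sub>R x + t *\<^sub>R y \<in> Q" by blast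
    define t where "t = e / 2"
    have t: "t > 0" using \<open>e > 0\<close> by (simp add: t_def)
    \<comment> \<open>A point of \<open>Q\<close> on the line through \<open>x\<close> and
      \<open>y\<close>, on the other side of \<open>x\<close> from \<open>y\<close>.\<close>
    define w where "w = (1 - (- t)) *\<^sub>R x + (- t) *\<^sub>R y"
    have w: "w \<in> Q" unfolding w_def using \<open>e > 0\<close> by (intro e) (simp add: t_def)
    have xw: "x = (1 - 1 / (1 + t)) *\<^sub>R y + (1 / (1 + t)) *\<^sub>R w"
    proof -
      have "(1 + t) *\<^sub>R x = t *\<^sub>R y + w" by (simp add: w_def algebra_simps)
      then have "x = (1 / (1 + t)) *\<^sub>R (t *\<^sub>R y + w)"
        using t by (metis add_pos_pos less_numeral_extra(1) less_numeral_extra(3) scaleR_one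
            scaleR_scaleR nonzero_divide_eq_eq)
      moreover have "1 - 1 / (1 + t) = t / (1 + t)" using t by (simp add: field_simps)
      ultimately show ?thesis by (simp add: scaleR_add_right)
    qed
    have "y \<noteq> w"
    proof
      assume "y = w"
      then have "x = y" using xw by (simp add: algebra_simps)
      with False show False by simp
    qed
    then have "x \<in> open_segment y w"
      using xw t by (auto simp: in_segment intro!: exI[of _ "1 / (1 + t)"])
    then show "y \<in> F" using F xF y w unfolding face_of_def by blast
  qed (use xF in simp)
  moreover have "y \<in> flat (supp x)" if y: "y \<in> F" for y
  proof -
    have "\<exists>e>1. (1 - e) *\<^sub>R y + e *\<^sub>R x \<in> F"
      using convex_rel_interior_iff[OF cF ne, of x] x y by blast
    then obtain e where e: "e > 1" and "(1 - e) *\<^sub>R y + e *\<^sub>R x \<in> F" by blast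
    then have "(1 - e) *\<^sub>R y + e *\<^sub>R x \<in> Q" using FQ by auto
    then have nn: "0 \<le> (1 - e) * l i y + e * l i x" if "i \<in> I" for i
      using that by (auto simp: Q_def l_affine)
    have "l i y = 0" if i: "i \<in> I" and z: "l i x = 0" for i
    proof -
      have "0 \<le> l i y" using y FQ i by (auto simp: Q_def)
      moreover have "0 \<le> (1 - e) * l i y" using nn[OF i] z by simp
      ultimately show ?thesis using e by (simp add: zero_le_mult_iff)
    qed
    then show ?thesis using y FQ by (auto simp: flat_def supp_def Q_def)
  qed
  ultimately have "F = Q \<inter> flat (supp x)" using FQ by blast
  with xF FQ show ?thesis using that by blast
qed

text \<open>Each \<open>y\<close> in the flat lies on the line through \<open>x\<close> and a nearby
  point of the flat that is still in \<open>Q\<close>, so the intersection spans the flat.\<close>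

lemma aff_dim_Int_flat:
  assumes x: "x \<in> Q"
  shows "aff_dim (Q \<inter> flat (supp x)) = aff_dim (flat (supp x))"
proof (rule antisym)
  show "aff_dim (Q \<inter> flat (supp x)) \<le> aff_dim (flat (supp x))"
    by (rule aff_dim_subset) auto
  have "y \<in> affine hull (Q \<inter> flat (supp x))" if y: "y \<in> flat (supp x)" for y
  proof -
    from prolong[OF x y] obtain e where "e > 0"
      and e: "\<And>t. \<bar>t\<bar> < e \<Longrightarrow> (1 - t) *\<^sub>R x + t *\<^sub>R y \<in> Q \<inter> flat (supp x)" by blast
    define t where "t = e / 2"
    have t: "t > 0" using \<open>e > 0\<close> by (simp add: t_def)
    define w where "w = (1 - t) *\<^sub>R x + t *\<^sub>R y"
    have w: "w \<in> Q \<inter> flat (supp x)"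
      unfolding w_def using \<open>e > 0\<close> by (intro e) (simp add: t_def)
    have xx: "x \<in> Q \<inter> flat (supp x)" using x by (auto simp: flat_def Q_def)
    have "y = (1 - 1 / t) *\<^sub>R x + (1 / t) *\<^sub>R w"
      using t by (simp add: w_def algebra_simps)
    then show ?thesis
      using mem_affine[OF affine_affine_hull hull_inc[OF xx] hull_inc[OF w],
          of "1 - 1 / t" "1 / t"] by simp
  qed
  then have "flat (supp x) \<subseteq> affine hull (Q \<inter> flat (supp x))" by blast
  then show "aff_dim (flat (supp x)) \<le> aff_dim (Q \<inter> flat (supp x))"
    using aff_dim_subset[of "flat (supp x)"] by (metis aff_dim_affine_hull)
qed

lemma f_poly_eq_sum_supports:
  assumes dm: "\<And>x. x \<in> Q \<Longrightarrow> aff_dim (flat (supp x)) = int (dm (supp x))"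
  shows "f_poly Q = (\<Sum>S\<in>supp ` Q. monom 1 (dm S))"
proof -
  define T where "T = supp ` Q"
  have "T \<subseteq> Pow I" by (auto simp: T_def supp_def)
  then have fin: "finite T" using finite_I by (simp add: finite_subset)
  have inj: "inj_on (\<lambda>S. Q \<inter> flat S) T"
  proof (rule inj_onI)
    fix S S' assume "S \<in> T" "S' \<in> T" and eq: "Q \<inter> flat S = Q \<inter> flat S'"
    then obtain x y where x: "x \<in> Q" "S = supp x" and y: "y \<in> Q" "S' = supp y"
      by (auto simp: T_def)
    have "x \<in> Q \<inter> flat S" "y \<in> Q \<inter> flat S'" using x y by (auto simp: flat_def Q_def)
    then have "x \<in> flat S'" "y \<in> flat S" using eq by auto
    then show "S = S'" using x y by (auto simp: flat_def)
  qed
  have dmT: "aff_dim (Q \<inter> flat S) = int (dm S)" if "S \<in> T" for S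
    using that dm aff_dim_Int_flat by (auto simp: T_def)
  have num: "face_number Q d = card {S \<in> T. dm S = d}" for d
  proof -
    have "{F. F face_of Q \<and> F \<noteq> {} \<and> aff_dim F = int d} = (\<lambda>S. Q \<inter> flat S) ` {S \<in> T. dm S = d}"
    proof (intro equalityI subsetI)
      fix F assume "F \<in> {F. F face_of Q \<and> F \<noteq> {} \<and> aff_dim F = int d}"
      then have F: "F face_of Q" "F \<noteq> {}" "aff_dim F = int d" by auto
      obtain x where x: "x \<in> Q" "F = Q \<inter> flat (supp x)"
        using face_of_eq_flat[OF F(1,2)] .
      have "supp x \<in> T" using x by (auto simp: T_def)
      with dmT[OF this] F(3) x show "F \<in> (\<lambda>S. Q \<inter> flat S) ` {S \<in> T. dm S = d}" by auto
    next
      fix F assume "F \<in> (\<lambda>S. Q \<inter> flat S) ` {S \<in> T. dm S = d}"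
      then obtain S where S: "S \<in> T" "dm S = d" "F = Q \<inter> flat S" by auto
      moreover have "F \<noteq> {}" using S by (auto simp: T_def flat_def Q_def)
      ultimately show "F \<in> {F. F face_of Q \<and> F \<noteq> {} \<and> aff_dim F = int d}"
        using dmT flat_face_of by auto
    qed
    then show ?thesis
      unfolding face_number_def
      by (simp add: card_image inj_on_subset[OF inj])
  qed
  \<comment> \<open>The sum defining \<open>f_poly\<close> stops at \<open>nat (aff_dim Q)\<close>;
    this bound ensures that no support is cut off when grouping by dimension.\<close>
  have le: "dm S \<le> nat (aff_dim Q)" if "S \<in> T" for S
    using aff_dim_subset[of "Q \<inter> flat S" Q] dmT[OF that] by simp
  have "f_poly Q = (\<Sum>d = 0..nat (aff_dim Q). \<Sum>S | S \<in> T \<and> dm S = d. monom 1 (dm S))"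
    unfolding f_poly_def num
    by (intro sum.cong refl)
      (simp add: of_nat_poly smult_monom)
  also have "\<dots> = (\<Sum>S\<in>T. monom 1 (dm S))"
    using le by (intro sum.group fin) auto
  finally show ?thesis by (simp add: T_def)
qed

end

section \<open>Dimension of an affine set from free coordinates\<close>

text \<open>The coordinates in \<open>J\<close> parametrize \<open>A\<close>: after translating
  \<open>A\<close> to a subspace, the projection to these coordinates is injective with image the
  full coordinate subspace of \<open>J\<close>.\<close>

lemma aff_dim_eq_card_coordinates:
  fixes A :: "(real ^ 'n::finite) set"
  assumes aff: "affine A"
    and inj: "\<And>x y. x \<in> A \<Longrightarrow> y \<in> A \<Longrightarrow> (\<And>j. j \<in> J \<Longrightarrow> x $ j = y $ j) \<Longrightarrow> x = y"
    and ex: "\<And>w :: 'n \<Rightarrow> real. \<exists>x\<in>A. \<forall>j\<in>J. x $ j = w j"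
  shows "aff_dim A = int (card J)"
proof -
  obtain x0 where x0: "x0 \<in> A" using ex by blast
  define V where "V = {y - x0 | y. y \<in> A}"
  have sub: "subspace V"
    using affine_diffs_subspace_subtract[OF aff x0]
    by (simp add: V_def image_def Setcompr_eq_image)
  define \<pi> :: "real ^ 'n \<Rightarrow> real ^ 'n" where "\<pi> v = (\<chi> i. if i \<in> J then v $ i else 0)" for v
  have lin: "linear \<pi>"
    by (rule linearI) (auto simp: \<pi>_def vec_eq_iff)
  have "inj_on \<pi> V"
  proof (rule inj_onI)
    fix u v assume "u \<in> V" "v \<in> V" and eq: "\<pi> u = \<pi> v"
    then obtain x y where xy: "x \<in> A" "y \<in> A" "u = x - x0" "v = y - x0" by (auto simp: V_def)
    have "x $ j = y $ j" if "j \<in> J" for j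
      using eq that xy by (auto simp: \<pi>_def vec_eq_iff dest: spec[of _ j])
    then show "u = v" using inj xy by simp
  qed
  then have "dim V = dim (\<pi> ` V)"
    using dim_image_eq[OF lin, of V] span_eq_iff[THEN iffD2, OF sub] by simp
  also have "\<pi> ` V = {w. \<forall>i. i \<notin> J \<longrightarrow> w $ i = 0}"
  proof (intro equalityI subsetI)
    fix w :: "real ^ 'n" assume w: "w \<in> {w. \<forall>i. i \<notin> J \<longrightarrow> w $ i = 0}"
    obtain x where "x \<in> A" "\<forall>j\<in>J. x $ j = w $ j + x0 $ j"
      using ex[of "\<lambda>j. w $ j + x0 $ j"] by blast
    then show "w \<in> \<pi> ` V"
      using w by (intro image_eqI[of _ _ "x - x0"]) (auto simp: \<pi>_def V_def vec_eq_iff)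
  qed (auto simp: \<pi>_def)
  also have "dim \<dots> = card J" using dim_substandard_cart[of J, where ?'a = real] by (simp add: dim_vec_eq)
  finally have "dim V = card J" .
  moreover have "A = (+) x0 ` V" by (force simp: V_def image_def)
  then have "aff_dim A = aff_dim V" by (simp add: aff_dim_translation_eq)
  ultimately show ?thesis using aff_dim_zero[of V] subspace_0[OF sub] sub
    by (simp add: hull_inc)
qed

section \<open>Generating functions of nonempty sets\<close>

lemma sum_Pow_power_card:
  fixes y :: "'a::comm_semiring_1"
  shows "(\<Sum>A\<in>Pow {..<n::nat}. y ^ card A) = (1 + y) ^ n"
proof -
  have "(1 + y) ^ n = (\<Prod>i<n. y + 1)" by (simp add: add.commute)
  also have "\<dots> = (\<Sum>A\<in>Pow {..<n}. y ^ card A)"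
    by (subst prod_add) auto
  finally show ?thesis ..
qed

text \<open>Subsets containing the new element \<open>n\<close> are \<open>insert n A\<close> with
  \<open>A\<close> arbitrary, possibly empty; their exponent is \<open>card A\<close>, so they
  contribute \<open>(1 + y) ^ n\<close>.\<close>

lemma sum_nonempty_power_card:
  fixes y :: "'a::comm_semiring_1"
  shows "(\<Sum>A\<in>Pow {..<n::nat} - {{}}. y ^ (card A - 1)) = (\<Sum>i<n. (1 + y) ^ i)"
proof (induction n)
  case (Suc n)
  have eq: "Pow {..<Suc n} - {{}} = (Pow {..<n} - {{}}) \<union> insert n ` Pow {..<n}"
    by (auto simp: lessThan_Suc Pow_insert)
  have "(\<Sum>A\<in>insert n ` Pow {..<n}. y ^ (card A - 1)) = (\<Sum>A\<in>Pow {..<n}. y ^ card A)"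
  proof (subst sum.reindex)
    show "inj_on (insert n) (Pow {..<n})"
      by (auto simp: inj_on_def insert_eq_iff)
    have "card (insert n A) = Suc (card A)" if "A \<in> Pow {..<n}" for A
      using that finite_subset[of A "{..<n}"] by (subst card_insert_disjoint) auto
    then show "sum ((\<lambda>A. y ^ (card A - 1)) \<circ> insert n) (Pow {..<n}) = (\<Sum>A\<in>Pow {..<n}. y ^ card A)"
      by (intro sum.cong) auto
  qed
  moreover have "(Pow {..<n} - {{}}) \<inter> insert n ` Pow {..<n} = {}" by auto
  ultimately show ?case
    unfolding eq
    by (simp add: sum.union_disjoint Suc.IH sum_Pow_power_card del: One_nat_def)
qed simp

section \<open>Supports of slack vectors and their generating function\<close>

text \<open>Truncated subtraction makes \<open>card C - 1\<close> zero also for \<open>C = {}\<close>, as the dimension requires.\<close>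

definition support_dim :: "nat set \<times> nat set \<times> bool set \<Rightarrow> nat" where
  "support_dim = (\<lambda>(A, B, C). (card A - 1) + (card B - 1) + (card C - 1))"

text \<open>\<open>A\<close> and \<open>B\<close> are the jump positions of the left and right
  chains. In \<open>C\<close>, \<open>False\<close> stands for the slack between the left chain and
  the apex, \<open>True\<close> for the one between the apex and the right chain.\<close>

definition supports :: "nat \<Rightarrow> (nat set \<times> nat set \<times> bool set) set" where
  "supports k = {(A, B, C). A \<subseteq> {..k} \<and> B \<subseteq> {..k} \<and> A \<noteq> {} \<and> B \<noteq> {} \<and>
     (C = {} \<longleftrightarrow> k \<notin> A \<and> k \<notin> B)}"

lemma bool_set_cases: "C = {} \<or> C = {True} \<or> C = {False} \<or> C = {True, False}"
proof -
  have "C \<in> Pow {True, False}" by (auto simp: UNIV_bool[symmetric])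
  then show ?thesis by (auto simp: Pow_insert)
qed

text \<open>For fixed \<open>A\<close> and \<open>B\<close> the sum over \<open>C\<close> is
  \<open>2 + y\<close>, or \<open>1\<close> if both avoid \<open>k\<close>. Writing \<open>1\<close>
  as \<open>(2 + y) - (1 + y)\<close> gives two terms, each of which factors into a sum over
  \<open>A\<close> times a sum over \<open>B\<close>.\<close>

lemma sum_supports:
  fixes y :: "'a::comm_ring_1"
  defines "g \<equiv> \<lambda>n. \<Sum>i<n. (1 + y) ^ i"
  shows "(\<Sum>S\<in>supports k. y ^ support_dim S) = (2 + y) * g (Suc k) ^ 2 - (1 + y) * g k ^ 2"
proof -
  define N where "N n = Pow {..<n::nat} - {{}}" for n
  define w where "w A = y ^ (card A - 1)" for A :: "nat set"
  define \<C> :: "nat set \<Rightarrow> nat set \<Rightarrow> bool set set" where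
    "\<C> A B = (if k \<in> A \<or> k \<in> B then {{True}, {False}, {True, False}} else {{}})" for A B
  have fin: "finite (N n)" for n by (simp add: N_def)
  have finC: "finite (\<C> A B)" for A B by (simp add: \<C>_def)
  have sub: "N k \<subseteq> N (Suc k)" by (auto simp: N_def)
  have mem_C: "C \<in> \<C> A B \<longleftrightarrow> (C = {} \<longleftrightarrow> k \<notin> A \<and> k \<notin> B)" for A B C
    using bool_set_cases[of C] by (auto simp: \<C>_def)
  have eq: "supports k = (SIGMA A:N (Suc k). SIGMA B:N (Suc k). \<C> A B)"
    by (auto simp: supports_def N_def mem_C lessThan_Suc_atMost)
  \<comment> \<open>Within \<open>N (Suc k)\<close>, membership in \<open>N k\<close> expresses that
    \<open>k\<close> is avoided.\<close>
  have sC: "(\<Sum>C\<in>\<C> A B. y ^ (card C - 1)) =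
      (2 + y) - (if A \<in> N k then 1 else 0) * (if B \<in> N k then 1 else 0) * (1 + y)"
    if "A \<in> N (Suc k)" "B \<in> N (Suc k)" for A B
  proof (cases "k \<in> A \<or> k \<in> B")
    case True
    then have "A \<notin> N k \<or> B \<notin> N k" by (auto simp: N_def)
    with True show ?thesis by (auto simp: \<C>_def)
  next
    case False
    then have "A \<in> N k \<and> B \<in> N k" using that by (auto simp: N_def less_Suc_eq)
    with False show ?thesis by (auto simp: \<C>_def)
  qed
  have gN: "(\<Sum>A\<in>N n. w A) = g n" for n
    unfolding N_def w_def g_def by (rule sum_nonempty_power_card)
  have gk: "(\<Sum>A\<in>N (Suc k). w A * (if A \<in> N k then 1 else 0)) = g k"
    unfolding gN[of k, symmetric] using sub fin
    by (intro sum.mono_neutral_cong_right) auto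
  have "(\<Sum>S\<in>supports k. y ^ support_dim S) =
      (\<Sum>A\<in>N (Suc k). \<Sum>B\<in>N (Suc k). \<Sum>C\<in>\<C> A B. w A * w B * y ^ (card C - 1))"
    unfolding eq using fin finC by (simp add: sum.Sigma support_dim_def w_def power_add split_def)
  also have "\<dots> = (\<Sum>A\<in>N (Suc k). \<Sum>B\<in>N (Suc k). (2 + y) * (w A * w B) -
      (1 + y) * ((w A * (if A \<in> N k then 1 else 0)) * (w B * (if B \<in> N k then 1 else 0))))"
    by (intro sum.cong refl, simp only: sum_distrib_left[symmetric] sC)
      (simp add: algebra_simps)
  also have "\<dots> = (2 + y) * ((\<Sum>A\<in>N (Suc k). w A) * (\<Sum>B\<in>N (Suc k). w B)) - (1 + y) *
      ((\<Sum>A\<in>N (Suc k). w A * (if A \<in> N k then 1 else 0)) *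
       (\<Sum>B\<in>N (Suc k). w B * (if B \<in> N k then 1 else 0)))"
    by (simp only: sum_subtractf sum_distrib_left[symmetric] sum_distrib_right[symmetric])
  also have "\<dots> = (2 + y) * g (Suc k) ^ 2 - (1 + y) * g k ^ 2"
    unfolding gN gk by (simp add: power2_eq_square)
  finally show ?thesis .
qed

text \<open>The induction adds \<open>q = monom 1 n\<close> to the sum \<open>p\<close> and expands
  the square; products with \<open>q\<close> only shift coefficients by \<open>n\<close>.\<close>

lemma coeff_geometric_square:
  "coeff ((\<Sum>i<n. monom 1 i)\<^sup>2 :: int poly) i =
     (if i < n then int i + 1 else if i < 2 * n then 2 * int n - 1 - int i else 0)"
proof (induction n)
  case (Suc n)
  have c: "coeff (\<Sum>i<n. monom 1 i :: int poly) j = (if j < n then 1 else 0)" for j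
    by (simp add: coeff_sum)
  have sq: "(p + q)\<^sup>2 = p\<^sup>2 + q * p + q * p + q * q" for p q :: "int poly"
    by (simp add: power2_eq_square algebra_simps)
  show ?case
  proof (cases "i < n")
    case True
    then show ?thesis
      unfolding sum.lessThan_Suc sq coeff_add Suc.IH coeff_monom_mult by simp
  next
    case False
    then obtain d where i: "i = n + d" using le_Suc_ex not_less by blast
    show ?thesis
      unfolding sum.lessThan_Suc sq coeff_add Suc.IH coeff_monom_mult c coeff_monom
      by (simp add: i)
  qed
qed simp

section \<open>Chains with prescribed jumps\<close>

text \<open>Jumps at indices in \<open>A\<close> are allowed, not forced, and may have either sign:
  such chains describe the affine flat of a face, not the face itself.\<close>

definition jump_chain :: "nat \<Rightarrow> nat set \<Rightarrow> real \<Rightarrow> real \<Rightarrow> (nat \<Rightarrow> real) \<Rightarrow> bool" where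
  "jump_chain k A p q e \<longleftrightarrow> e 0 = p \<and> e (Suc k) = q \<and> (\<forall>i\<le>k. i \<notin> A \<longrightarrow> e (Suc i) = e i)"

lemma jump_chain_after_Max:
  assumes e: "jump_chain k A p q e" and A: "finite A" and i: "Max A < i" "i \<le> Suc k"
  shows "e i = q"
  using i(2,1)
proof (induction rule: inc_induct)
  case (step n)
  then have "n \<notin> A" using A by (meson Max_ge leD)
  with step e show ?case by (auto simp: jump_chain_def)
qed (use e in \<open>simp add: jump_chain_def\<close>)

text \<open>The values right after all jumps but the last are the free parameters; the last jump
  must land on \<open>q\<close>. This is the source of \<open>card A - 1\<close> in the
  dimension.\<close>

lemma jump_chain_unique:
  assumes e: "jump_chain k A p q e" and e': "jump_chain k A p q e'" and A: "finite A"
    and agree: "\<And>i. i \<in> A - {Max A} \<Longrightarrow> e (Suc i) = e' (Suc i)"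
    and "i \<le> Suc k"
  shows "e i = e' i"
  using \<open>i \<le> Suc k\<close>
proof (induction i)
  case 0
  then show ?case using e e' by (simp add: jump_chain_def)
next
  case (Suc i)
  consider "i \<notin> A" | "i \<in> A - {Max A}" | "i = Max A" by blast
  then show ?case
  proof cases
    case 1
    then show ?thesis using Suc e e' by (simp add: jump_chain_def)
  next
    case 2
    then show ?thesis by (rule agree)
  next
    case 3
    then show ?thesis
      using jump_chain_after_Max[OF e A] jump_chain_after_Max[OF e' A] Suc by simp
  qed
qed

lemma jump_chain_exists:
  assumes A: "A \<subseteq> {..k}" "A \<noteq> {}"
  shows "\<exists>e. jump_chain k A p q e \<and> (\<forall>i\<in>A - {Max A}. e (Suc i) = w i)"
proof -
  \<comment> \<open>Each jump before the last takes its prescribed value, and the jump at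
    \<open>Max A\<close> goes to the end value \<open>q\<close>.\<close>
  define e where
    "e = rec_nat p (\<lambda>i v. if i \<in> A then if i = Max A then q else w i else v)"
  have e0: "e 0 = p" by (simp add: e_def)
  have eS: "e (Suc i) = (if i \<in> A then if i = Max A then q else w i else e i)" for i
    by (simp add: e_def)
  have fin: "finite A" using A(1) finite_subset by blast
  have tail: "Max A < i \<Longrightarrow> e i = q" for i
  proof (induction i)
    case (Suc i)
    show ?case
    proof (cases "i = Max A")
      case True
      then show ?thesis using eS Max_in[OF fin A(2)] by simp
    next
      case False
      then have "Max A < i" using Suc by simp
      then show ?thesis using eS Suc.IH Max_ge[OF fin, of i] by auto
    qed
  qed simp
  have "Max A < Suc k" using Max_in[OF fin A(2)] A(1) by auto
  then have "e (Suc k) = q" by (rule tail)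
  moreover have "e (Suc i) = e i" if "i \<notin> A" for i using eS that by simp
  ultimately have "jump_chain k A p q e" using e0 by (simp add: jump_chain_def)
  then show ?thesis using eS by (intro exI[of _ e]) auto
qed

text \<open>The total change \<open>q - p\<close> is shared equally, with
  \<open>d = 1 / card A\<close>. Keeping \<open>q - p\<close> as a factor makes \<open>d\<close>
  positive for ascending and descending chains alike.\<close>

lemma jump_chain_equal_steps:
  assumes A: "A \<subseteq> {..k}" "A \<noteq> {}"
  obtains e d where "jump_chain k A p q e" "d > 0"
    "\<And>i. e (Suc i) - e i = (if i \<in> A then d * (q - p) else 0)"
proof
  have fin: "finite A" using A(1) finite_subset by blast
  define d where "d = 1 / real (card A)"
  define e where "e i = p + d * (q - p) * card (A \<inter> {..<i})" for i
  show d: "d > 0" using fin A(2) by (simp add: d_def card_gt_0_iff)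
  show eS: "e (Suc i) - e i = (if i \<in> A then d * (q - p) else 0)" for i
  proof -
    have "A \<inter> {..<Suc i} = (if i \<in> A then insert i (A \<inter> {..<i}) else A \<inter> {..<i})"
      by (auto simp: less_Suc_eq)
    then show ?thesis using fin by (simp add: e_def algebra_simps)
  qed
  have "A \<inter> {..<Suc k} = A" using A by auto
  then have "e (Suc k) = q" using d by (simp add: e_def d_def)
  moreover have "e (Suc i) = e i" if "i \<notin> A" for i using eS[of i] that by simp
  ultimately show "jump_chain k A p q e" by (simp add: jump_chain_def e_def)
qed

section \<open>The polytope in chain coordinates\<close>

lemma GZ_interlacingD:
  assumes "x \<in> GZ c lam" "1 \<le> i" "i < length lam" "1 \<le> j" "j \<le> length lam - i"
  shows "GZ_coord c lam x (i - 1) j \<le> GZ_coord c lam x i j"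
    "GZ_coord c lam x i j \<le> GZ_coord c lam x (i - 1) (j + 1)"
proof -
  have "(i, j) \<in> GZ_index (length lam)" using assms by (auto simp: GZ_index_def)
  with assms(1) show "GZ_coord c lam x (i - 1) j \<le> GZ_coord c lam x i j"
    "GZ_coord c lam x i j \<le> GZ_coord c lam x (i - 1) (j + 1)"
    by (auto simp: GZ_def)
qed

locale GZ_one_twos_three =
  fixes k :: nat and c :: "nat \<times> nat \<Rightarrow> 'n::finite"
  assumes k_pos: "k \<ge> 1" and labelling: "GZ_labelling (k + 2) c"
begin

text \<open>Index \<open>0\<close> carries the entry of the given sequence and index
  \<open>Suc k\<close> the constant \<open>2\<close> bounding the chain, so that the chain has
  \<open>k + 1\<close> slacks, the last being \<open>2 - left x k\<close>.\<close>

definition left :: "real ^ 'n \<Rightarrow> nat \<Rightarrow> real" where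
  "left x i = (if i = 0 then 1 else if i \<le> k then x $ c (i, 1) else 2)"

definition right :: "real ^ 'n \<Rightarrow> nat \<Rightarrow> real" where
  "right x i = (if i = 0 then 3 else if i \<le> k then x $ c (i, k + 2 - i) else 2)"

definition apex :: "real ^ 'n \<Rightarrow> real" where
  "apex x = x $ c (Suc k, 1)"

definition middle :: "(real ^ 'n) set" where
  "middle = {x. \<forall>i j. 1 \<le> i \<longrightarrow> 2 \<le> j \<longrightarrow> i + j \<le> k + 1 \<longrightarrow> x $ c (i, j) = 2}"

fun slack :: "nat + nat + bool \<Rightarrow> real ^ 'n \<Rightarrow> real" where
  "slack (Inl i) x = left x (Suc i) - left x i"
| "slack (Inr (Inl i)) x = right x i - right x (Suc i)"
| "slack (Inr (Inr False)) x = apex x - left x k"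
| "slack (Inr (Inr True)) x = right x k - apex x"

definition slack_index :: "(nat + nat + bool) set" where
  "slack_index = {..k} <+> {..k} <+> UNIV"

lemma inj_c: "inj_on c (GZ_index (k + 2))" and surj_c: "c ` GZ_index (k + 2) = UNIV"
  using labelling by (auto simp: GZ_labelling_def bij_betw_def)

lemma chain_values_eqI:
  assumes "x \<in> middle" "y \<in> middle"
    and l: "\<And>i. i \<le> k \<Longrightarrow> left x i = left y i"
    and r: "\<And>i. i \<le> k \<Longrightarrow> right x i = right y i"
    and a: "apex x = apex y"
  shows "x = y"
  unfolding vec_eq_iff
proof
  fix n
  obtain i j where n: "n = c (i, j)" and "(i, j) \<in> GZ_index (k + 2)"
    using surj_c by (metis UNIV_I image_iff surj_pair)
  then have ij: "1 \<le> i" "i \<le> Suc k" "1 \<le> j" "j \<le> k + 2 - i" by (auto simp: GZ_index_def)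
  \<comment> \<open>The triangle splits into the apex, its left edge, its right edge and the
    interior entries fixed by \<open>middle\<close>.\<close>
  consider "i = Suc k" "j = 1" | "i \<le> k" "j = 1" | "i \<le> k" "j = k + 2 - i"
    | "2 \<le> j" "i + j \<le> k + 1"
    using ij by linarith
  then show "x $ n = y $ n"
  proof cases
    case 1
    then show ?thesis using a n by (simp add: apex_def)
  next
    case 2
    then show ?thesis using l[of i] n ij by (simp add: left_def)
  next
    case 3
    then show ?thesis using r[of i] n ij by (simp add: right_def)
  next
    case 4
    then show ?thesis using assms(1,2) n ij by (simp add: middle_def)
  qed
qed

lemma chain_values_exist:
  assumes "e 0 = 1" "e (Suc k) = 2" "e' 0 = 3" "e' (Suc k) = 2"
  obtains x where "x \<in> middle" "\<And>i. i \<le> Suc k \<Longrightarrow> left x i = e i"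
    "\<And>i. i \<le> Suc k \<Longrightarrow> right x i = e' i" "apex x = z"
proof
  \<comment> \<open>The apex is tested first because \<open>(Suc k, 1)\<close> also satisfies the
    conditions of both edges.\<close>
  define f where "f = (\<lambda>(i, j). if i = Suc k then z else if j = 1 then e i
    else if i + j = k + 2 then e' i else (2::real))"
  define x :: "real ^ 'n" where "x = (\<chi> n. f (inv_into (GZ_index (k + 2)) c n))"
  have xc: "x $ c p = f p" if "p \<in> GZ_index (k + 2)" for p
    using that inj_c by (simp add: x_def inv_into_f_f)
  show "x \<in> middle"
    by (auto simp: middle_def xc GZ_index_def f_def)
  show "left x i = e i" if "i \<le> Suc k" for i
    using assms that by (auto simp: left_def xc GZ_index_def f_def le_Suc_eq)
  show "right x i = e' i" if "i \<le> Suc k" for i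
    using assms that by (auto simp: right_def xc GZ_index_def f_def le_Suc_eq)
  show "apex x = z"
    by (auto simp: apex_def xc GZ_index_def f_def)
qed

lemma left_comb: "left ((1 - t) *\<^sub>R x + t *\<^sub>R y) i = (1 - t) * left x i + t * left y i"
  by (simp add: left_def algebra_simps)

lemma right_comb: "right ((1 - t) *\<^sub>R x + t *\<^sub>R y) i = (1 - t) * right x i + t * right y i"
  by (simp add: right_def algebra_simps)

lemma apex_comb: "apex ((1 - t) *\<^sub>R x + t *\<^sub>R y) = (1 - t) * apex x + t * apex y"
  by (simp add: apex_def)

lemma ball_slack_index:
  "(\<forall>i\<in>slack_index. R i) \<longleftrightarrow> (\<forall>i\<le>k. R (Inl i)) \<and> (\<forall>i\<le>k. R (Inr (Inl i))) \<and>
     R (Inr (Inr False)) \<and> R (Inr (Inr True))"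
  by (auto simp: slack_index_def Plus_def UNIV_bool)

sublocale affine_system middle slack_index slack
proof
  show "affine middle"
    unfolding affine_def middle_def by (auto simp: distrib_right[symmetric])
  show "finite slack_index" by (simp add: slack_index_def)
  have "\<forall>i\<in>slack_index. \<forall>t x y.
      slack i ((1 - t) *\<^sub>R x + t *\<^sub>R y) = (1 - t) * slack i x + t * slack i y"
    unfolding ball_slack_index slack.simps left_comb right_comb apex_comb
    by (simp add: algebra_simps)
  then show "slack i ((1 - t) *\<^sub>R x + t *\<^sub>R y) = (1 - t) * slack i x + t * slack i y"
    if "i \<in> slack_index" for i t x y
    using that by blast
qed

lemma mem_Q_iff:
  "x \<in> Q \<longleftrightarrow> x \<in> middle \<and> (\<forall>i\<le>k. left x i \<le> left x (Suc i)) \<and>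
     (\<forall>i\<le>k. right x (Suc i) \<le> right x i) \<and> left x k \<le> apex x \<and> apex x \<le> right x k"
  by (simp add: Q_def ball_slack_index)

lemma GZ_eq_Q: "GZ c ([1] @ replicate k 2 @ [3]) = Q"
proof (intro equalityI subsetI)
  define lam :: "real list" where "lam = [1] @ replicate k 2 @ [3]"
  have len: "length lam = k + 2" by (simp add: lam_def)
  have lam: "lam ! 0 = 1" "lam ! Suc k = 3" "1 \<le> j \<Longrightarrow> j \<le> k \<Longrightarrow> lam ! j = 2" for j
    by (auto simp: lam_def nth_append nth_Cons')
  define u where "u = GZ_coord c lam"
  have u_left: "u x i 1 = left x i" if "i \<le> k" for x i
    using that by (auto simp: u_def GZ_coord_def left_def lam)
  have u_right: "u x i (k + 2 - i) = right x i" if "i \<le> k" for x i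
    using that by (auto simp: u_def GZ_coord_def right_def lam)
  have u_apex: "u x (Suc k) 1 = apex x" for x
    by (simp add: u_def GZ_coord_def apex_def)
  show "x \<in> Q" if x: "x \<in> GZ c ([1] @ replicate k 2 @ [3])" for x
  proof -
    have lo: "u x (i - 1) j \<le> u x i j" and hi: "u x i j \<le> u x (i - 1) (j + 1)"
      if "1 \<le> i" "i \<le> Suc k" "1 \<le> j" "j \<le> k + 2 - i" for i j
      using GZ_interlacingD[of x c lam i j] that x len by (auto simp: u_def lam_def)
    \<comment> \<open>Row \<open>0\<close> is included, where these are the copies of
      \<open>2\<close>; each later entry is squeezed between two entries equal to \<open>2\<close>
      in the row above.\<close>
    have mid: "2 \<le> j \<Longrightarrow> i + j \<le> k + 1 \<Longrightarrow> u x i j = 2" for i j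
    proof (induction i arbitrary: j)
      case 0
      then show ?case using lam(3)[of "j - 1"] by (simp add: u_def GZ_coord_def)
    next
      case (Suc i)
      then have "j \<le> k + 2 - Suc i" by linarith
      with Suc show ?case using lo[of "Suc i" j] hi[of "Suc i" j] by simp
    qed
    have "x \<in> middle"
      using mid by (fastforce simp: middle_def u_def GZ_coord_def)
    moreover have "left x i \<le> left x (Suc i)" if "i \<le> k" for i
    proof (cases "i = k")
      case True
      \<comment> \<open>The bound at the end of the chain comes from the entry in row
        \<open>k - 1\<close>, column \<open>2\<close>; for \<open>k = 1\<close> this is the given
        value in row \<open>0\<close>.\<close>
      have "u x k 1 \<le> u x (k - 1) 2" using hi[of k 1] k_pos by (simp add: numeral_2_eq_2)
      also have "\<dots> = 2" using mid[of 2 "k - 1"] k_pos by simp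
      finally show ?thesis using True u_left[of k x] by (simp add: left_def)
    next
      case False
      then show ?thesis using lo[of "Suc i" 1] that u_left[of i x] u_left[of "Suc i" x] by simp
    qed
    moreover have "right x (Suc i) \<le> right x i" if "i \<le> k" for i
    proof (cases "i = k")
      case True
      have "2 = u x (k - 1) 2" using mid[of 2 "k - 1"] k_pos by simp
      also have "\<dots> \<le> u x k 2" using lo[of k 2] k_pos by simp
      finally show ?thesis using True u_right[of k x] by (simp add: right_def)
    next
      case False
      then have "Suc (k + 2 - Suc i) = k + 2 - i" using that by simp
      then show ?thesis
        using hi[of "Suc i" "k + 2 - Suc i"] that False u_right[of i x] u_right[of "Suc i" x]
        by simp
    qed
    moreover have "left x k \<le> apex x" "apex x \<le> right x k"
      using lo[of "Suc k" 1] hi[of "Suc k" 1] u_left[of k x] u_right[of k x] u_apex[of x]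
      by (simp_all add: numeral_2_eq_2)
    ultimately show ?thesis by (simp add: mem_Q_iff)
  qed
  show "x \<in> GZ c ([1] @ replicate k 2 @ [3])" if "x \<in> Q" for x
  proof -
    have x: "x \<in> middle" and l: "\<And>i. i \<le> k \<Longrightarrow> left x i \<le> left x (Suc i)"
      and r: "\<And>i. i \<le> k \<Longrightarrow> right x (Suc i) \<le> right x i"
      and a: "left x k \<le> apex x" "apex x \<le> right x k"
      using that by (auto simp: mem_Q_iff)
    have mid: "u x i j = 2" if "2 \<le> j" "i + j \<le> k + 1" for i j
      using x that lam(3)[of "j - 1"] by (auto simp: u_def GZ_coord_def middle_def)
    \<comment> \<open>Going back from the end value \<open>2\<close>. This supplies the upper
      interlacing bound of a left edge entry, whose upper right neighbour is \<open>2\<close>, and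
      \<open>r2\<close> does the same on the right.\<close>
    have l2: "left x i \<le> 2" if "i \<le> Suc k" for i
      using that
    proof (induction rule: inc_induct)
      case (step n)
      then show ?case using l[of n] by simp
    qed (simp add: left_def)
    have r2: "2 \<le> right x i" if "i \<le> Suc k" for i
      using that
    proof (induction rule: inc_induct)
      case (step n)
      then show ?case using r[of n] by simp
    qed (simp add: right_def)
    have "u x (i - 1) j \<le> u x i j \<and> u x i j \<le> u x (i - 1) (j + 1)"
      if ij: "1 \<le> i" "i \<le> Suc k" "1 \<le> j" "j \<le> k + 2 - i" for i j
    proof -
      consider "i = Suc k" "j = 1" | "i \<le> k" "j = 1" | "i \<le> k" "j = k + 2 - i"
        | "2 \<le> j" "i + j \<le> k + 1"
        using ij by linarith
      then show ?thesis
      proof cases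
        case 1
        then show ?thesis
          using a u_left[of k x] u_right[of k x] u_apex[of x] by (simp add: numeral_2_eq_2)
      next
        case 2
        then show ?thesis
          using l[of "i - 1"] l2[of i] u_left[of i x] u_left[of "i - 1" x] mid[of 2 "i - 1"] ij
          by (simp add: numeral_2_eq_2)
      next
        case 3
        then have "j + 1 = k + 2 - (i - 1)" using ij by simp
        then show ?thesis
          using r[of "i - 1"] r2[of i] u_right[of i x] u_right[of "i - 1" x] mid[of j "i - 1"] ij 3
          by simp
      next
        case 4
        then show ?thesis
          using mid[of j i] mid[of j "i - 1"] mid[of "j + 1" "i - 1"] ij by simp
      qed
    qed
    then have "x \<in> GZ c lam"
      unfolding GZ_def len u_def[symmetric] by (auto simp: GZ_index_def)
    then show ?thesis by (simp add: lam_def)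
  qed
qed

section \<open>Which supports occur\<close>

definition enc :: "nat set \<times> nat set \<times> bool set \<Rightarrow> (nat + nat + bool) set" where
  "enc = (\<lambda>(A, B, C). A <+> B <+> C)"

lemma inj_enc: "inj enc"
proof (rule injI)
  fix S S' assume eq: "enc S = enc S'"
  obtain A B C A' B' C' where S: "S = (A, B, C)" "S' = (A', B', C')" by (metis prod_cases3)
  have "Inl i \<in> enc S \<longleftrightarrow> Inl i \<in> enc S'" "Inr (Inl i) \<in> enc S \<longleftrightarrow> Inr (Inl i) \<in> enc S'"
    "Inr (Inr b) \<in> enc S \<longleftrightarrow> Inr (Inr b) \<in> enc S'" for i b
    using eq by simp_all
  then show "S = S'" by (auto simp: S enc_def)
qed

lemma mem_enc:
  "Inl i \<in> enc (A, B, C) \<longleftrightarrow> i \<in> A"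
  "Inr (Inl i) \<in> enc (A, B, C) \<longleftrightarrow> i \<in> B"
  "Inr (Inr b) \<in> enc (A, B, C) \<longleftrightarrow> b \<in> C"
  by (auto simp: enc_def)

lemma chain_ends: "left x 0 = 1" "left x (Suc k) = 2" "right x 0 = 3" "right x (Suc k) = 2"
  by (simp_all add: left_def right_def)

lemma mem_flat_enc_iff:
  "x \<in> flat (enc (A, B, C)) \<longleftrightarrow> x \<in> middle \<and>
     jump_chain k A 1 2 (left x) \<and> jump_chain k B 3 2 (right x) \<and>
     (False \<notin> C \<longrightarrow> apex x = left x k) \<and> (True \<notin> C \<longrightarrow> apex x = right x k)"
proof -
  have "supp x \<subseteq> S \<longleftrightarrow> (\<forall>i\<in>slack_index. i \<notin> S \<longrightarrow> slack i x = 0)" for S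
    by (auto simp: supp_def)
  moreover have "right x i - right x (Suc i) = 0 \<longleftrightarrow> right x (Suc i) = right x i"
    "right x k - apex x = 0 \<longleftrightarrow> apex x = right x k" for i by auto
  ultimately show ?thesis
    by (simp only: flat_def mem_Collect_eq ball_slack_index jump_chain_def mem_enc chain_ends
        slack.simps right_minus_eq simp_thms conj_assoc)
qed

text \<open>A chain without jumps would be constant, against its distinct end values. The apex
  slacks are nonnegative and add up to the sum of the two last chain slacks, so they vanish together
  exactly when those do.\<close>

lemma supp_in_supports:
  assumes x: "x \<in> Q"
  shows "supp x \<in> enc ` supports k"
proof -
  define A where "A = {i. i \<le> k \<and> left x (Suc i) \<noteq> left x i}"
  define B where "B = {i. i \<le> k \<and> right x (Suc i) \<noteq> right x i}"
  define C where "C = {b. slack (Inr (Inr b)) x \<noteq> 0}"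
  have "supp x = enc (A, B, C)"
    unfolding supp_def by (auto simp: slack_index_def enc_def A_def B_def C_def)
  moreover have "A \<noteq> {}"
  proof
    assume "A = {}"
    then have "i \<le> Suc k \<Longrightarrow> left x i = 1" for i
      by (induction i) (auto simp: A_def left_def[of x 0])
    from this[of "Suc k"] show False by (simp add: left_def)
  qed
  moreover have "B \<noteq> {}"
  proof
    assume "B = {}"
    then have "i \<le> Suc k \<Longrightarrow> right x i = 3" for i
      by (induction i) (auto simp: B_def right_def[of x 0])
    from this[of "Suc k"] show False by (simp add: right_def)
  qed
  moreover have "C = {} \<longleftrightarrow> k \<notin> A \<and> k \<notin> B"
  proof -
    have "left x k \<le> 2" "2 \<le> right x k" "left x k \<le> apex x" "apex x \<le> right x k"
      using x by (auto simp: mem_Q_iff left_def[of x "Suc k"] right_def[of x "Suc k"])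
    then show ?thesis
      by (auto simp: A_def B_def C_def all_bool_eq left_def[of x "Suc k"] right_def[of x "Suc k"])
  qed
  moreover have "A \<subseteq> {..k}" "B \<subseteq> {..k}" by (auto simp: A_def B_def)
  ultimately show ?thesis by (auto simp: supports_def)
qed

lemma supports_realized:
  assumes "S \<in> supports k"
  shows "\<exists>x\<in>Q. supp x = enc S"
proof -
  obtain A B C where S: "S = (A, B, C)" and A: "A \<subseteq> {..k}" "A \<noteq> {}" and B: "B \<subseteq> {..k}" "B \<noteq> {}"
    and C: "C = {} \<longleftrightarrow> k \<notin> A \<and> k \<notin> B"
    using assms by (auto simp: supports_def)
  obtain e d where e: "jump_chain k A 1 2 e" "d > 0"
    "\<And>i. e (Suc i) - e i = (if i \<in> A then d * (2 - 1) else 0)"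
    using jump_chain_equal_steps[OF A] by blast
  obtain e' d' where e': "jump_chain k B 3 2 e'" "d' > 0"
    "\<And>i. e' (Suc i) - e' i = (if i \<in> B then d' * (2 - 3) else 0)"
    using jump_chain_equal_steps[OF B] by blast
  \<comment> \<open>The apex sits at one chain end if the slack to that end must vanish, and at the
    midpoint if both slacks must be positive.\<close>
  define z where
    "z = (if False \<notin> C then e k else if True \<notin> C then e' k else (e k + e' k) / 2)"
  obtain x where x: "x \<in> middle" "\<And>i. i \<le> Suc k \<Longrightarrow> left x i = e i"
    "\<And>i. i \<le> Suc k \<Longrightarrow> right x i = e' i" "apex x = z"
    using chain_values_exist[of e e' z] e(1) e'(1) by (auto simp: jump_chain_def)
  have sl: "left x (Suc i) - left x i = (if i \<in> A then d else 0)" if "i \<le> k" for i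
    using e(3)[of i] x(2) that by simp
  have sr: "right x i - right x (Suc i) = (if i \<in> B then d' else 0)" if "i \<le> k" for i
    using e'(3)[of i] x(3) that by (auto split: if_splits)
  have "left x k = 2 - (if k \<in> A then d else 0)" "right x k = 2 + (if k \<in> B then d' else 0)"
    using sl[of k] sr[of k] by (simp_all add: left_def right_def)
  then have ek: "e k = 2 - (if k \<in> A then d else 0)" "e' k = 2 + (if k \<in> B then d' else 0)"
    using x by simp_all
  have sz: "e k \<le> z" "z \<le> e' k" "z = e k \<longleftrightarrow> False \<notin> C" "z = e' k \<longleftrightarrow> True \<notin> C"
  proof -
    have C_cases: "C \<noteq> {} \<longleftrightarrow> False \<in> C \<or> True \<in> C" by (metis (full_types) ex_in_conv)
    have le: "e k \<le> e' k" using ek e(2) e'(2) by auto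
    \<comment> \<open>The chain ends differ whenever \<open>C\<close> is nonempty, so the slack to
      the other end is then positive, as required.\<close>
    have "e k = e' k \<longleftrightarrow> C = {}" using ek e(2) e'(2) C by auto
    then show "e k \<le> z" "z \<le> e' k" "z = e k \<longleftrightarrow> False \<notin> C" "z = e' k \<longleftrightarrow> True \<notin> C"
      using le C_cases by (auto simp: z_def)
  qed
  have "0 \<le> left x (Suc i) - left x i" "0 \<le> right x i - right x (Suc i)" if "i \<le> k" for i
    using sl[OF that] sr[OF that] e(2) e'(2) by simp_all
  then have "x \<in> Q" using sz x by (simp add: mem_Q_iff)
  moreover have "supp x = enc S"
  proof -
    have "\<forall>i\<in>slack_index. slack i x \<noteq> 0 \<longleftrightarrow> i \<in> enc S"
      unfolding ball_slack_index using sl sr sz x e(2) e'(2) by (auto simp: S enc_def)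
    moreover have "enc S \<subseteq> slack_index"
      using A B by (auto simp: S enc_def slack_index_def)
    ultimately show ?thesis by (auto simp: supp_def)
  qed
  ultimately show ?thesis by blast
qed

section \<open>Dimensions of the faces\<close>

text \<open>Free coordinates are the values after all jumps but the last in each chain, and the apex
  if both its slacks may be nonzero; otherwise the apex is tied to a chain end.\<close>

lemma aff_dim_flat_enc:
  assumes "S \<in> supports k"
  shows "aff_dim (flat (enc S)) = int (support_dim S)"
proof -
  obtain A B C where S: "S = (A, B, C)" and A: "A \<subseteq> {..k}" "A \<noteq> {}" and B: "B \<subseteq> {..k}" "B \<noteq> {}"
    and C: "C = {} \<longleftrightarrow> k \<notin> A \<and> k \<notin> B"
    using assms by (auto simp: supports_def)
  have fin: "finite A" "finite B" using A(1) B(1) finite_subset by blast+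
  define JA where "JA = (\<lambda>i. (Suc i, 1::nat)) ` (A - {Max A})"
  \<comment> \<open>Column \<open>k + 1 - i\<close> is the right edge of row
    \<open>Suc i\<close>.\<close>
  define JB where "JB = (\<lambda>i. (Suc i, k + 1 - i)) ` (B - {Max B})"
  define JC where "JC = (if False \<in> C \<and> True \<in> C then {(Suc k, 1::nat)} else {})"
  \<comment> \<open>With the last jump left out, \<open>Suc i\<close> is at most \<open>k\<close>,
    so the value there is a genuine coordinate and not the constant \<open>2\<close>.\<close>
  have ltA: "i < k" if "i \<in> A - {Max A}" for i
  proof -
    have "i \<le> Max A" "Max A \<in> A" "i \<noteq> Max A" using that fin Max_in[OF fin(1) A(2)] by auto
    then show ?thesis using A(1) by fastforce
  qed
  have ltB: "i < k" if "i \<in> B - {Max B}" for i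
  proof -
    have "i \<le> Max B" "Max B \<in> B" "i \<noteq> Max B" using that fin Max_in[OF fin(2) B(2)] by auto
    then show ?thesis using B(1) by fastforce
  qed
  have JA: "1 \<le> fst p \<and> fst p \<le> k \<and> snd p = 1" if "p \<in> JA" for p
    using that ltA unfolding JA_def by fastforce
  have JB: "1 \<le> fst p \<and> fst p \<le> k \<and> snd p = k + 2 - fst p" if "p \<in> JB" for p
    using that ltB unfolding JB_def by fastforce
  have JC: "fst p = Suc k \<and> snd p = 1" if "p \<in> JC" for p
    using that by (auto simp: JC_def split: if_splits)
  have "p \<in> GZ_index (k + 2)" if "p \<in> JA \<union> JB \<union> JC" for p
    using that JA[of p] JB[of p] JC[of p] by (cases p) (auto simp: GZ_index_def)
  then have "JA \<union> JB \<union> JC \<subseteq> GZ_index (k + 2)" by blast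
  then have "card (c ` (JA \<union> JB \<union> JC)) = card (JA \<union> JB \<union> JC)"
    by (intro card_image inj_on_subset[OF inj_c])
  also have "\<dots> = card JA + card JB + card JC"
  proof -
    have "p \<notin> JC" if "p \<in> JA \<union> JB" for p using that JA[of p] JB[of p] JC[of p] by auto
    then have "(JA \<union> JB) \<inter> JC = {}" by blast
    moreover have "p \<notin> JB" if "p \<in> JA" for p using that JA[of p] JB[of p] by auto
    then have "JA \<inter> JB = {}" by blast
    moreover have "finite JA" "finite JB" "finite JC" using fin by (auto simp: JA_def JB_def JC_def)
    ultimately show ?thesis by (simp add: card_Un_disjoint)
  qed
  also have "card JA = card A - 1"
    unfolding JA_def using fin A by (subst card_image) (auto simp: inj_on_def)
  also have "card JB = card B - 1"
    unfolding JB_def using fin B by (subst card_image) (auto simp: inj_on_def)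
  also have "card JC = card C - 1"
  proof -
    consider "C = {}" | "C = {True}" | "C = {False}" | "C = {True, False}"
      using bool_set_cases by blast
    then show ?thesis by cases (simp_all add: JC_def)
  qed
  finally have card: "card (c ` (JA \<union> JB \<union> JC)) = support_dim S"
    by (simp add: S support_dim_def)
  have left_JA: "left x (Suc i) = x $ c (Suc i, 1)" "c (Suc i, 1) \<in> c ` (JA \<union> JB \<union> JC)"
    if "i \<in> A - {Max A}" for x i
    using ltA[OF that] that by (auto simp: left_def JA_def)
  have right_JB: "right x (Suc i) = x $ c (Suc i, k + 1 - i)"
    "c (Suc i, k + 1 - i) \<in> c ` (JA \<union> JB \<union> JC)" if "i \<in> B - {Max B}" for x i
    using ltB[OF that] that by (auto simp: right_def JB_def)
  have "aff_dim (flat (enc S)) = int (card (c ` (JA \<union> JB \<union> JC)))"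
  proof (rule aff_dim_eq_card_coordinates[OF affine_flat])
    fix x y assume "x \<in> flat (enc S)" "y \<in> flat (enc S)"
      and agree: "\<And>j. j \<in> c ` (JA \<union> JB \<union> JC) \<Longrightarrow> x $ j = y $ j"
    then have x: "x \<in> middle" "jump_chain k A 1 2 (left x)" "jump_chain k B 3 2 (right x)"
        "False \<notin> C \<Longrightarrow> apex x = left x k" "True \<notin> C \<Longrightarrow> apex x = right x k"
      and y: "y \<in> middle" "jump_chain k A 1 2 (left y)" "jump_chain k B 3 2 (right y)"
        "False \<notin> C \<Longrightarrow> apex y = left y k" "True \<notin> C \<Longrightarrow> apex y = right y k"
      by (auto simp: S mem_flat_enc_iff)
    have l: "left x i = left y i" if "i \<le> k" for i
      using jump_chain_unique[OF x(2) y(2) fin(1), of i] left_JA agree that by simp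
    have r: "right x i = right y i" if "i \<le> k" for i
      using jump_chain_unique[OF x(3) y(3) fin(2), of i] right_JB agree that by simp
    have "apex x = apex y"
    proof (cases "False \<in> C \<and> True \<in> C")
      case True
      then show ?thesis using agree by (simp add: apex_def JC_def)
    next
      case False
      then show ?thesis using x y l[of k] r[of k] by auto
    qed
    then show "x = y" using chain_values_eqI[OF x(1) y(1)] l r by blast
  next
    fix w :: "'n \<Rightarrow> real"
    obtain e where e: "jump_chain k A 1 2 e" "\<And>i. i \<in> A - {Max A} \<Longrightarrow> e (Suc i) = w (c (Suc i, 1))"
      using jump_chain_exists[OF A, of 1 2 "\<lambda>i. w (c (Suc i, 1))"] by auto
    obtain e' where e': "jump_chain k B 3 2 e'"
      "\<And>i. i \<in> B - {Max B} \<Longrightarrow> e' (Suc i) = w (c (Suc i, k + 1 - i))"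
      using jump_chain_exists[OF B, of 3 2 "\<lambda>i. w (c (Suc i, k + 1 - i))"] by auto
    define z where
      "z = (if False \<notin> C then e k else if True \<notin> C then e' k else w (c (Suc k, 1)))"
    obtain x where x: "x \<in> middle" "\<And>i. i \<le> Suc k \<Longrightarrow> left x i = e i"
      "\<And>i. i \<le> Suc k \<Longrightarrow> right x i = e' i" "apex x = z"
      using chain_values_exist[of e e' z] e(1) e'(1) by (auto simp: jump_chain_def)
    \<comment> \<open>If \<open>C\<close> is empty, the apex must equal both chain ends; neither
      chain may jump at \<open>k\<close>, so both ends are \<open>2\<close> and the equations
      agree.\<close>
    have "False \<notin> C \<Longrightarrow> True \<notin> C \<Longrightarrow> e k = e' k"
    proof -
      assume "False \<notin> C" "True \<notin> C"
      then have "C = {}" using bool_set_cases[of C] by auto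
      then show "e k = e' k" using C e(1) e'(1) unfolding jump_chain_def by (metis order_refl)
    qed
    then have "x \<in> flat (enc S)"
      using x e(1) e'(1) by (auto simp: S mem_flat_enc_iff jump_chain_def z_def)
    moreover have "x $ j = w j" if j: "j \<in> c ` (JA \<union> JB \<union> JC)" for j
    proof -
      consider p where "p \<in> JA" "j = c p" | p where "p \<in> JB" "j = c p"
        | p where "p \<in> JC" "j = c p"
        using j by blast
      then show ?thesis
      proof cases
        case 1
        then obtain i where i: "i \<in> A - {Max A}" "j = c (Suc i, 1)" unfolding JA_def by blast
        show ?thesis
          using i(2) left_JA(1)[OF i(1), of x] ltA[OF i(1)] x(2)[of "Suc i"] e(2)[OF i(1)] by simp
      next
        case 2
        then obtain i where i: "i \<in> B - {Max B}" "j = c (Suc i, k + 1 - i)" unfolding JB_def by blast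
        show ?thesis
          using i(2) right_JB(1)[OF i(1), of x] ltB[OF i(1)] x(3)[of "Suc i"] e'(2)[OF i(1)] by simp
      next
        case 3
        then have "False \<in> C" "True \<in> C" "j = c (Suc k, 1)"
          by (auto simp: JC_def split: if_splits)
        then show ?thesis using x(4) by (simp add: apex_def z_def)
      qed
    qed
    ultimately show "\<exists>x\<in>flat (enc S). \<forall>j\<in>c ` (JA \<union> JB \<union> JC). x $ j = w j" by blast
  qed
  then show ?thesis by (simp add: card)
qed

lemma supp_image_Q: "supp ` Q = enc ` supports k"
proof
  show "supp ` Q \<subseteq> enc ` supports k" using supp_in_supports by blast
  show "enc ` supports k \<subseteq> supp ` Q"
  proof
    fix T assume "T \<in> enc ` supports k"
    then obtain S where "S \<in> supports k" "T = enc S" by blast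
    with supports_realized[of S] show "T \<in> supp ` Q" by (metis image_eqI)
  qed
qed

section \<open>The f-polynomial, the dimension and the h-polynomial\<close>

lemma f_poly_Q: "f_poly Q = (\<Sum>S\<in>supports k. monom 1 (support_dim S))"
proof -
  have "f_poly Q = (\<Sum>S\<in>supp ` Q. monom 1 ((support_dim \<circ> inv enc) S))"
  proof (rule f_poly_eq_sum_supports)
    fix x assume "x \<in> Q"
    then obtain S where "S \<in> supports k" "supp x = enc S" using supp_in_supports by blast
    then show "aff_dim (flat (supp x)) = int ((support_dim \<circ> inv enc) (supp x))"
      using aff_dim_flat_enc inj_enc by simp
  qed
  then show ?thesis
    unfolding supp_image_Q using inj_enc by (simp add: sum.reindex inj_on_subset)
qed

text \<open>The full support is realized, and its face is \<open>Q\<close> itself, of dimension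
  \<open>k + k + 1\<close>.\<close>

lemma aff_dim_Q: "aff_dim Q = 2 * int k + 1"
proof -
  define S where "S = ({..k}, {..k}, UNIV :: bool set)"
  have S: "S \<in> supports k" by (auto simp: S_def supports_def)
  obtain x where x: "x \<in> Q" "supp x = enc S" using supports_realized[OF S] by blast
  have "enc S = slack_index" by (simp add: S_def enc_def slack_index_def)
  then have "Q \<inter> flat (supp x) = Q"
    using x by (auto simp: flat_def supp_def Q_def)
  then have "aff_dim Q = int (support_dim S)"
    using aff_dim_Int_flat[OF x(1)] aff_dim_flat_enc[OF S] x(2) by simp
  then show ?thesis by (simp add: S_def support_dim_def)
qed

lemma h_poly_Q:
  "h_poly Q = monom 1 1 * (\<Sum>i<Suc k. monom 1 i)\<^sup>2 + (\<Sum>i<Suc k. monom 1 i)\<^sup>2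
     - monom 1 1 * (\<Sum>i<k. monom 1 i)\<^sup>2"
proof -
  have monom_power: "monom 1 n = (monom 1 1 :: int poly) ^ n" for n
    by (simp add: monom_power)
  \<comment> \<open>With \<open>y = X - 1\<close> the powers of \<open>1 + y\<close> in
    \<open>sum_supports\<close> become powers of \<open>X\<close>.\<close>
  define y where "y = [:-1, 1 :: int:]"
  have y: "1 + y = monom 1 1" "2 + y = monom 1 1 + 1"
    by (simp_all add: y_def monom_altdef numeral_poly one_pCons)
  have "pcompose (monom 1 n) y = y ^ n" for n
    by (induction n) (simp_all add: monom_Suc pcompose_pCons pcompose_1)
  then have "h_poly Q = (\<Sum>S\<in>supports k. y ^ support_dim S)"
    by (simp add: h_poly_def f_poly_Q pcompose_sum y_def)
  also have "\<dots> = (monom 1 1 + 1) * (\<Sum>i<Suc k. monom 1 i)\<^sup>2 - monom 1 1 * (\<Sum>i<k. monom 1 i)\<^sup>2"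
    unfolding sum_supports y monom_power[symmetric] ..
  finally show ?thesis by (simp add: distrib_right)
qed

end

theorem mainTheorem2:
  fixes k :: nat
    and c :: "nat \<times> nat \<Rightarrow> 'n::finite"
    and P :: "(real ^ 'n) set"
  assumes "k \<ge> 1"
    and "GZ_labelling (k + 2) c"
  defines "P \<equiv> GZ c ([1] @ replicate k 2 @ [3])"
  shows "aff_dim P = 2 * int k + 1 \<and>
         coeff (h_poly P) (2 * k + 1) = 1 \<and>
         (\<forall>i. i \<le> k + 1 \<longrightarrow> coeff (h_poly P) i = int i + 1) \<and>
         (\<forall>i. k + 1 < i \<and> i \<le> 2 * k \<longrightarrow> coeff (h_poly P) i = 2 * int k + 3 - int i)"
proof -
  interpret GZ_one_twos_three k c
    using assms by unfold_locales
  have P: "P = Q" unfolding P_def by (rule GZ_eq_Q)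
  define b where
    "b n i = (if i < n then int i + 1 else if i < 2 * n then 2 * int n - 1 - int i else 0)" for n i
  have b: "coeff ((\<Sum>i<n. monom 1 i)\<^sup>2 :: int poly) i = b n i" for n i
    unfolding b_def by (rule coeff_geometric_square)
  \<comment> \<open>The factor \<open>monom 1 1\<close> shifts coefficients by one. At
    \<open>i = 2 * k + 1\<close>, \<open>b k (2 * k)\<close> is \<open>0\<close> where its linear
    formula would give \<open>-1\<close>; this is why the top coefficient is \<open>1\<close> and
    not \<open>2\<close>.\<close>
  have "coeff (h_poly P) i = (if i = 0 then 0 else b (Suc k) (i - 1) - b k (i - 1)) + b (Suc k) i" for i
    unfolding P h_poly_Q coeff_diff coeff_add coeff_monom_mult b by (cases i) simp_all
  then show ?thesis
    using aff_dim_Q k_pos by (auto simp: P b_def)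
qed

end
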